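(* Let $\mathcal{N}=(\mathcal{V},\mathcal{E},S,\mathbf{T})$ be a network and $\mathcal{A}$ an alphabet. Let $\mathcal{N}'$ be the network obtained from $\mathcal{N}$ by adding a new vertex $S'$ and $\mu(\mathcal{N})$ parallel edges $e_1',\dots,e_{\mu(\mathcal{N})}'$ from $S'$ to $S$, with source $S'$ and terminal set $\mathbf{T}$ (so that $S$ becomes an intermediate vertex of $\mathcal{N}'$). Let $\mathcal{F}$ be a network code for $(\mathcal{N}',\mathcal{A})$, and let $\mathcal{F}_S:\mathcal{A}^{\mu(\mathcal{N})}\to\mathcal{A}^{|\mathrm{out}(S)|}$ be its function at $S$. If $(\mathcal{A}^{\mu(\mathcal{N})},\mathcal{F})$ is unambiguous for $(\mathcal{N}',\mathcal{A})$, then $(\mathcal{C},\mathcal{F}\setminus\{\mathcal{F}_S\})$ is unambiguous for $(\mathcal{N},\mathcal{A})$, where $$\mathcal{C}=\{\mathcal{F}_S(x) : x\in\mathcal{A}^{\mu(\mathcal{N})}\}.$$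
   Context: A (single-source) network is a tuple $\mathcal{N}=(\mathcal{V},\mathcal{E},S,\mathbf{T})$ where $(\mathcal{V},\mathcal{E})$ is a finite directed acyclic multigraph, $S\in\mathcal{V}$ is the source, $\mathbf{T}\subseteq\mathcal{V}\setminus\{S\}$ is a nonempty set of terminals, the source has no incoming edges, terminals have no outgoing edges, there is a directed path from $S$ to every terminal, and every other (intermediate) vertex lies on a directed path from $S$ to it and has a directed path to some terminal. $\mathrm{in}(V)$ and $\mathrm{out}(V)$ denote the sets of incoming and outgoing edges of $V$. An alphabet $\mathcal{A}$ is a finite set with at least 2 elements; each edge carries exactly one symbol of $\mathcal{A}$. The edges are totally ordered by some fixed total order extending the partial order "$e\preccurlyeq e'$ if there is a directed path starting with $e$ and ending with $e'$" (the choice of extension does not matter), and this is used to index coordinates. A network code for $(\mathcal{N},\mathcal{A})$ is a family $\mathcal{F}=\{\mathcal{F}_V\}$, indexed by the intermediate vertices, of functions $\mathcal{F}_V:\mathcal{A}^{|\mathrm{in}(V)|}\to\mathcal{A}^{|\mathrm{out}(V)|}$. For a terminal $T$, $\Omega[\mathcal{N},\mathcal{F},S\to T]:\mathcal{A}^{|\mathrm{out}(S)|}\to\mathcal{A}^{|\mathrm{in}(T)|}$ is the function that sends the vector of symbols emitted by $S$ on its outgoing edges to the vector of symbols arriving on the incoming edges of $T$ when every intermediate vertex $V$ applies $\mathcal{F}_V$ to its incoming symbols. An outer code is a nonempty subset $\mathcal{C}\subseteq\mathcal{A}^{|\mathrm{out}(S)|}$. The pair $(\mathcal{C},\mathcal{F})$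 is unambiguous for $(\mathcal{N},\mathcal{A})$ if for every $T\in\mathbf{T}$ the function $\Omega[\mathcal{N},\mathcal{F},S\to T]$ is injective on $\mathcal{C}$. $\mu(\mathcal{N})=\min_{T\in\mathbf{T}}\text{min-cut}_{\mathcal{N}}(S,T)$, where $\text{min-cut}_{\mathcal{N}}(S,T)$ is the minimum number of edges one needs to remove from $\mathcal{N}$ in order to disconnect $S$ from $T$ (no directed path from $S$ to $T$ remains). $\mathcal{F}\setminus\{\mathcal{F}_S\}$ denotes the family obtained from $\mathcal{F}$ by dropping the function at $S$; it is a network code for $(\mathcal{N},\mathcal{A})$. *)

theory Defs
  imports "Graph_Theory.Arc_Walk" "HOL-Library.FuncSet"
begin

text \<open>
  A network is a directed multigraph with a source and a set of terminals.
  Vertices and edges are the verts and arcs of a \<^typ>\<open>('v, 'e) pre_digraph\<close>.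
\<close>

record ('v, 'e) net =
  dgr :: "('v, 'e) pre_digraph"
  source :: 'v
  terminals :: "'v set"

definition intermediate :: "('v, 'e) net \<Rightarrow> 'v set" where
  "intermediate N = verts (dgr N) - {source N} - terminals N"

locale network = fin_digraph "dgr N" for N :: "('v, 'e) net" +
  assumes acyclic: "\<nexists>p. cycle p"
    and source_in_verts: "source N \<in> verts (dgr N)"
    and terminals_subset: "terminals N \<subseteq> verts (dgr N) - {source N}"
    and terminals_nonempty: "terminals N \<noteq> {}"
    and source_no_in: "in_arcs (dgr N) (source N) = {}"
    and terminal_no_out: "T \<in> terminals N \<Longrightarrow> out_arcs (dgr N) T = {}"
    and terminal_reachable: "T \<in> terminals N \<Longrightarrow> source N \<rightarrow>\<^sup>*\<^bsub>dgr N\<^esub> T"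
    and intermediate_reachable: "V \<in> intermediate N \<Longrightarrow> source N \<rightarrow>\<^sup>*\<^bsub>dgr N\<^esub> V"
    and intermediate_reaches: "V \<in> intermediate N \<Longrightarrow> \<exists>T\<in>terminals N. V \<rightarrow>\<^sup>*\<^bsub>dgr N\<^esub> T"

definition min_cut :: "('v, 'e) pre_digraph \<Rightarrow> 'v \<Rightarrow> 'v \<Rightarrow> nat" where
  "min_cut G u v =
     Min (card ` {D. D \<subseteq> arcs G \<and> \<not> u \<rightarrow>\<^sup>*\<^bsub>G\<lparr>arcs := arcs G - D\<rparr>\<^esub> v})"

definition mu :: "('v, 'e) net \<Rightarrow> nat" where
  "mu N = Min (min_cut (dgr N) (source N) ` terminals N)"

text \<open>
  The network obtained by adding a new source \<open>s'\<close> and the parallel edges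
  \<open>e' 1, \<dots>, e' (mu N)\<close> from \<open>s'\<close> to the old source.  It is only meaningful
  if \<open>s'\<close> and these edges are new and the edges are pairwise distinct.
\<close>

definition add_source :: "('v, 'e) net \<Rightarrow> 'v \<Rightarrow> (nat \<Rightarrow> 'e) \<Rightarrow> ('v, 'e) net" where
  "add_source N s' e' =
     \<lparr>dgr = \<lparr>verts = insert s' (verts (dgr N)),
             arcs = arcs (dgr N) \<union> e' ` {1..mu N},
             tail = (\<lambda>e. if e \<in> e' ` {1..mu N} then s' else tail (dgr N) e),
             head = (\<lambda>e. if e \<in> e' ` {1..mu N} then source N else head (dgr N) e)\<rparr>,
      source = s',
      terminals = terminals N\<rparr>"


text \<open>
  Total orders of the edges that extend the path order, and the list of the
  elements of a set of edges in increasing order.  This list fixes which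
  coordinate of a vector of symbols belongs to which edge.
\<close>

definition edge_order :: "('v, 'e) net \<Rightarrow> ('e \<times> 'e) set \<Rightarrow> bool" where
  "edge_order N r \<longleftrightarrow>
     linear_order_on (arcs (dgr N)) r \<and>
     (\<forall>u p v. pre_digraph.apath (dgr N) u p v \<and> p \<noteq> [] \<longrightarrow> (hd p, last p) \<in> r)"

definition coords :: "('e \<times> 'e) set \<Rightarrow> 'e set \<Rightarrow> 'e list" where
  "coords r X = (THE es. set es = X \<and> distinct es \<and> sorted_wrt (\<lambda>d e. (d, e) \<in> r) es)"


text \<open>Vectors in \<open>A\<^sup>n\<close> are lists of length \<open>n\<close>.\<close>

definition alphabet :: "'a set \<Rightarrow> bool" where
  "alphabet A \<longleftrightarrow> finite A \<and> card A \<ge> 2"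

definition vectors :: "'a set \<Rightarrow> nat \<Rightarrow> 'a list set" where
  "vectors A n = {x. set x \<subseteq> A \<and> length x = n}"

definition network_code ::
    "('v, 'e) net \<Rightarrow> 'a set \<Rightarrow> ('v \<Rightarrow> 'a list \<Rightarrow> 'a list) \<Rightarrow> bool" where
  "network_code N A F \<longleftrightarrow>
     F \<in> (\<Pi>\<^sub>E V\<in>intermediate N.
            vectors A (in_degree (dgr N) V) \<rightarrow> vectors A (out_degree (dgr N) V))"

definition outer_code :: "('v, 'e) net \<Rightarrow> 'a set \<Rightarrow> 'a list set \<Rightarrow> bool" where
  "outer_code N A C \<longleftrightarrow> C \<noteq> {} \<and> C \<subseteq> vectors A (out_degree (dgr N) (source N))"

text \<open>
  \<open>transmission N r F x w\<close>: the edges carry the symbols \<open>w\<close> when the source emits \<open>x\<close>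
  and every intermediate vertex applies its function.  By acyclicity there is exactly
  one such \<open>w\<close> (lemma \<open>transmission_ex1\<close> below).
\<close>

definition transmission :: "('v, 'e) net \<Rightarrow> ('e \<times> 'e) set \<Rightarrow>
    ('v \<Rightarrow> 'a list \<Rightarrow> 'a list) \<Rightarrow> 'a list \<Rightarrow> ('e \<Rightarrow> 'a) \<Rightarrow> bool" where
  "transmission N r F x w \<longleftrightarrow>
     w \<in> extensional (arcs (dgr N)) \<and>
     map w (coords r (out_arcs (dgr N) (source N))) = x \<and>
     (\<forall>V\<in>intermediate N. map w (coords r (out_arcs (dgr N) V)) =
                          F V (map w (coords r (in_arcs (dgr N) V))))"

definition transfer_fun :: "('v, 'e) net \<Rightarrow> ('e \<times> 'e) set \<Rightarrow>
    ('v \<Rightarrow> 'a list \<Rightarrow> 'a list) \<Rightarrow> 'v \<Rightarrow> 'a list \<Rightarrow> 'a list" where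
  "transfer_fun N r F T x =
     map (THE w. transmission N r F x w) (coords r (in_arcs (dgr N) T))"

definition unambiguous :: "('v, 'e) net \<Rightarrow> ('e \<times> 'e) set \<Rightarrow> 'a set \<Rightarrow>
    'a list set \<Rightarrow> ('v \<Rightarrow> 'a list \<Rightarrow> 'a list) \<Rightarrow> bool" where
  "unambiguous N r A C F \<longleftrightarrow>
     network_code N A F \<and> outer_code N A C \<and>
     (\<forall>T\<in>terminals N. inj_on (transfer_fun N r F T) C)"


text \<open>The definite descriptions above are well defined.\<close>

lemma coords_ex1:
  assumes r: "linear_order_on E r" and X: "X \<subseteq> E" "finite X"
  shows "\<exists>!es. set es = X \<and> distinct es \<and> sorted_wrt (\<lambda>d e. (d, e) \<in> r) es"
proof (rule ex_ex1I)
  have tr: "trans r" and tot: "total_on E r" and as: "antisym r" and rf: "refl_on E r"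
    using r by (auto simp: linear_order_on_def partial_order_on_def preorder_on_def)
  have mx: "\<exists>m\<in>Y. \<forall>y\<in>Y. (y, m) \<in> r" if "finite Y" "Y \<noteq> {}" "Y \<subseteq> E" for Y
    using that
  proof (induction rule: finite_ne_induct)
    case (singleton y) then show ?case using rf by (auto simp: refl_on_def)
  next
    case (insert y Y)
    then obtain m where m: "m \<in> Y" "\<forall>z\<in>Y. (z, m) \<in> r" by auto
    have "m \<in> E" "y \<in> E" "m \<noteq> y" using m insert by auto
    then consider "(y, m) \<in> r" | "(m, y) \<in> r"
      using tot unfolding total_on_def by blast
    then show ?case
    proof cases
      case 1 then show ?thesis using m by auto
    next
      case 2
      have "(z, y) \<in> r" if "z \<in> Y" for z using 2 m that tr by (meson transD)
      moreover have "(y, y) \<in> r" using rf \<open>y \<in> E\<close> by (auto simp: refl_on_def)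
      ultimately show ?thesis by auto
    qed
  qed
  show "\<exists>es. set es = X \<and> distinct es \<and> sorted_wrt (\<lambda>d e. (d, e) \<in> r) es"
    using X(2,1)
  proof (induction rule: finite_remove_induct)
    case empty then show ?case by auto
  next
    case (remove Y)
    then obtain m where m: "m \<in> Y" "\<forall>y\<in>Y. (y, m) \<in> r" using mx by metis
    then obtain es where "set es = Y - {m}" "distinct es" "sorted_wrt (\<lambda>d e. (d, e) \<in> r) es"
      using remove by blast
    then have "set (es @ [m]) = Y \<and> distinct (es @ [m]) \<and>
        sorted_wrt (\<lambda>d e. (d, e) \<in> r) (es @ [m])"
      using m by (auto simp: sorted_wrt_append)
    then show ?case by blast
  qed
  have uniq: "es = fs" if "set es = set fs" "distinct es" "distinct fs"
    "sorted_wrt (\<lambda>d e. (d, e) \<in> r) es" "sorted_wrt (\<lambda>d e. (d, e) \<in> r) fs" for es fs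
    using that
  proof (induction es arbitrary: fs)
    case Nil then show ?case by simp
  next
    case (Cons e es)
    then obtain f fs' where f: "fs = f # fs'" by (cases fs) auto
    have "e = f"
    proof (rule ccontr)
      assume "e \<noteq> f"
      then have "f \<in> set es" "e \<in> set fs'" using Cons.prems(1) f by auto
      then have "(e, f) \<in> r" "(f, e) \<in> r" using Cons.prems f by auto
      then show False using as \<open>e \<noteq> f\<close> by (auto dest: antisymD)
    qed
    moreover have "set es = set fs'" using Cons.prems \<open>e = f\<close> f by auto
    ultimately show ?case using Cons f by auto
  qed
  fix es fs
  assume "set es = X \<and> distinct es \<and> sorted_wrt (\<lambda>d e. (d, e) \<in> r) es"
    "set fs = X \<and> distinct fs \<and> sorted_wrt (\<lambda>d e. (d, e) \<in> r) fs"
  then show "es = fs" using uniq by blast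
qed

lemma coords:
  assumes "linear_order_on E r" "X \<subseteq> E" "finite X"
  shows set_coords: "set (coords r X) = X"
    and distinct_coords: "distinct (coords r X)"
    and sorted_coords: "sorted_wrt (\<lambda>d e. (d, e) \<in> r) (coords r X)"
    and length_coords: "length (coords r X) = card X"
proof -
  have *: "set (coords r X) = X \<and> distinct (coords r X) \<and>
      sorted_wrt (\<lambda>d e. (d, e) \<in> r) (coords r X)"
    unfolding coords_def by (rule theI') (rule coords_ex1[OF assms])
  show "set (coords r X) = X" "distinct (coords r X)"
    "sorted_wrt (\<lambda>d e. (d, e) \<in> r) (coords r X)" using * by auto
  show "length (coords r X) = card X" using * distinct_card by metis
qed

lemma (in network) consecutive_edges:
  assumes r: "edge_order N r"
    and d: "d \<in> arcs (dgr N)" and e: "e \<in> arcs (dgr N)" and de: "head (dgr N) d = tail (dgr N) e"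
  shows "(d, e) \<in> r \<and> d \<noteq> e"
proof -
  have cyc: "cycle p" if "awalk u p u" "distinct (tl (awalk_verts u p))" "p \<noteq> []" for u p
    using that unfolding cycle_def by blast
  have 1: "tail (dgr N) c \<noteq> head (dgr N) c" if c: "c \<in> arcs (dgr N)" for c
    using cyc[of "tail (dgr N) c" "[c]"] acyclic c by (auto simp: awalk_def)
  have 2: "tail (dgr N) d \<noteq> head (dgr N) e"
    using cyc[of "tail (dgr N) d" "[d, e]"] acyclic d e de 1[OF e] by (auto simp: awalk_def)
  have "apath (tail (dgr N) d) [d, e] (head (dgr N) e)"
    using d e de 1[OF d] 1[OF e] 2 by (auto simp: apath_def awalk_def)
  then show ?thesis using r 1[OF d] de unfolding edge_order_def by fastforce
qed

lemma (in network) tail_cases: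
  assumes "e \<in> arcs (dgr N)"
  shows "tail (dgr N) e = source N \<or> tail (dgr N) e \<in> intermediate N"
proof -
  have "e \<in> out_arcs (dgr N) (tail (dgr N) e)" using assms by simp
  then have "tail (dgr N) e \<notin> terminals N" using terminal_no_out by blast
  then show ?thesis using assms by (auto simp: intermediate_def)
qed

lemma (in network) transmission_ex1:
  assumes r: "edge_order N r" and F: "network_code N A F"
    and x: "x \<in> vectors A (out_degree (dgr N) (source N))"
  shows "\<exists>!w. transmission N r F x w"
proof (rule ex_ex1I)
  let ?G = "dgr N"
  define R where "R = {(d, e). d \<in> arcs ?G \<and> e \<in> arcs ?G \<and> head ?G d = tail ?G e}"
  have lin: "linear_order_on (arcs ?G) r" using r by (simp add: edge_order_def)
  have wfR: "wf R"
  proof -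
    have "R \<subseteq> measure (\<lambda>e. card {d \<in> arcs ?G. (d, e) \<in> r})"
    proof clarify
      fix d e assume "(d, e) \<in> R"
      then have de: "d \<in> arcs ?G" "e \<in> arcs ?G" "head ?G d = tail ?G e" by (auto simp: R_def)
      then have *: "(d, e) \<in> r" "d \<noteq> e" using consecutive_edges[OF r] by auto
      have tr: "trans r" and as: "antisym r" and rf: "refl_on (arcs ?G) r"
        using lin by (auto simp: linear_order_on_def partial_order_on_def preorder_on_def)
      have "(e, e) \<in> r" "(e, d) \<notin> r" using rf as de * by (auto simp: refl_on_def dest: antisymD)
      then have "{c \<in> arcs ?G. (c, d) \<in> r} \<subset> {c \<in> arcs ?G. (c, e) \<in> r}"
        using * de tr by (auto dest: transD)
      then show "(d, e) \<in> measure (\<lambda>e. card {d \<in> arcs ?G. (d, e) \<in> r})"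
        by (auto intro: psubset_card_mono)
    qed
    then show ?thesis by (rule wf_subset[OF wf_measure])
  qed
  let ?o = "\<lambda>V. coords r (out_arcs ?G V)" and ?i = "\<lambda>V. coords r (in_arcs ?G V)"
  have out: "set (?o V) = out_arcs ?G V" "distinct (?o V)" "length (?o V) = out_degree ?G V" for V
    using coords[OF lin, of "out_arcs ?G V"] by (simp_all add: out_degree_def out_arcs_def)
  have inn: "set (?i V) = in_arcs ?G V" "length (?i V) = in_degree ?G V" for V
    using coords[OF lin, of "in_arcs ?G V"] by (simp_all add: in_degree_def in_arcs_def)
  {
    define H where "H = (\<lambda>f e. the (map_of (zip (?o (tail ?G e))
      (if tail ?G e = source N then x else F (tail ?G e) (map f (?i (tail ?G e))))) e))"
    define w where "w = wfrec R H"
    have w: "w e = H w e" if "e \<in> arcs ?G" for e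
    proof -
      have *: "w e = H (cut w R e) e" unfolding w_def by (rule wfrec[OF wfR])
      have "map (cut w R e) (?i (tail ?G e)) = map w (?i (tail ?G e))"
        using that by (auto simp: inn cut_def R_def)
      then have "H (cut w R e) e = H w e" by (simp only: H_def)
      with * show ?thesis by simp
    qed
    define val where "val = (\<lambda>V. if V = source N then x else F V (map w (?i V)))"
    have wval: "w e = the (map_of (zip (?o (tail ?G e)) (val (tail ?G e))) e)"
      if "e \<in> arcs ?G" for e using w[OF that] by (simp add: H_def val_def)
    have eq: "map w (?o V) = val V" if "length (val V) = length (?o V)" for V
    proof (rule nth_equalityI)
      fix i assume "i < length (map w (?o V))"
      then have i: "i < length (?o V)" by simp
      then have "?o V ! i \<in> out_arcs ?G V" using out(1) nth_mem by blast
      then show "map w (?o V) ! i = val V ! i"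
        using wval[of "?o V ! i"] i that out(2)[of V] by (auto simp: map_of_zip_nth)
    qed (use that in simp)
    have valA: "val V \<in> vectors A (out_degree ?G V)"
      if "V = source N \<or> V \<in> intermediate N" "\<And>d. d \<in> in_arcs ?G V \<Longrightarrow> w d \<in> A" for V
    proof (cases "V = source N")
      case True then show ?thesis using x by (simp add: val_def)
    next
      case False
      then have V: "V \<in> intermediate N" using that by auto
      have "map w (?i V) \<in> vectors A (in_degree ?G V)"
        using that(2) by (auto simp: vectors_def inn)
      then show ?thesis using F V False unfolding network_code_def val_def by auto
    qed
    have wA: "e \<in> arcs ?G \<Longrightarrow> w e \<in> A" for e
    proof (induction e rule: wf_induct_rule[OF wfR])
      case (1 e)
      have v: "val (tail ?G e) \<in> vectors A (out_degree ?G (tail ?G e))"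
        using 1 by (intro valA tail_cases) (auto simp: R_def)
      then have "map w (?o (tail ?G e)) = val (tail ?G e)"
        using out by (intro eq) (auto simp: vectors_def)
      moreover have "e \<in> set (?o (tail ?G e))" using 1 out by auto
      ultimately have "w e \<in> set (val (tail ?G e))" by (metis imageI list.set_map)
      then show ?case using v by (auto simp: vectors_def)
    qed
    have all: "map w (?o V) = val V" if "V = source N \<or> V \<in> intermediate N" for V
      using valA[OF that] wA out by (intro eq) (auto simp: vectors_def)
    have ro: "map (restrict w (arcs ?G)) (?o V) = map w (?o V)"
      and ri: "map (restrict w (arcs ?G)) (?i V) = map w (?i V)" for V
      by (auto simp: out inn)
    have "transmission N r F x (restrict w (arcs ?G))"
      unfolding transmission_def ro ri using all
      by (auto simp: val_def intermediate_def)
    then show "\<exists>w. transmission N r F x w" by blast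
  }
  fix w w' assume t: "transmission N r F x w" "transmission N r F x w'"
  have "e \<in> arcs ?G \<Longrightarrow> w e = w' e" for e
  proof (induction e rule: wf_induct_rule[OF wfR])
    case (1 e)
    let ?V = "tail ?G e"
    have i: "map w (?i ?V) = map w' (?i ?V)" using 1 by (auto simp: inn R_def)
    have "map w (?o ?V) = map w' (?o ?V)"
    proof (cases "?V = source N")
      case True then show ?thesis using t by (simp add: transmission_def)
    next
      case False
      then have "?V \<in> intermediate N" using tail_cases 1 by auto
      then have "map w (?o ?V) = F ?V (map w (?i ?V))" "map w' (?o ?V) = F ?V (map w' (?i ?V))"
        using t unfolding transmission_def by blast+
      then show ?thesis using i by metis
    qed
    moreover have "e \<in> set (?o ?V)" using 1 out by auto
    ultimately show ?case by simp
  qed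
  then show "w = w'" using t by (auto simp: transmission_def intro: extensionalityI)
qed

text \<open>The extension by a new source is again a network.\<close>

lemma (in network) mu_pos: "mu N > 0"
proof -
  have f: "finite (terminals N)" using terminals_subset finite_verts finite_subset by blast
  have "min_cut (dgr N) (source N) T > 0" if T: "T \<in> terminals N" for T
  proof -
    let ?C = "{D. D \<subseteq> arcs (dgr N) \<and>
      \<not> source N \<rightarrow>\<^sup>*\<^bsub>dgr N\<lparr>arcs := arcs (dgr N) - D\<rparr>\<^esub> T}"
    have fC: "finite ?C" by (rule finite_subset[of _ "Pow (arcs (dgr N))"]) auto
    have "T \<noteq> source N" using terminals_subset T by auto
    then have "arcs (dgr N) \<in> ?C"
      by (auto dest!: reachable_rtranclI simp: arcs_ends_def)
    moreover have "card D > 0" if "D \<in> ?C" for D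
    proof -
      have "D \<noteq> {}" using that terminal_reachable[OF T] by auto
      moreover have "finite D" using that finite_subset finite_arcs by blast
      ultimately show ?thesis by auto
    qed
    ultimately show ?thesis unfolding min_cut_def using fC
      by (subst Min_gr_iff) auto
  qed
  then show ?thesis unfolding mu_def using f terminals_nonempty
    by (subst Min_gr_iff) auto
qed

lemma (in network) network_add_source:
  assumes s': "s' \<notin> verts (dgr N)" and e': "e' ` {1..mu N} \<inter> arcs (dgr N) = {}"
  shows "network (add_source N s' e')"
proof -
  define N' where "N' = add_source N s' e'"
  let ?G = "dgr N" and ?H = "dgr N'"
  let ?E = "e' ` {1..mu N}"
  have H [simp]: "verts ?H = insert s' (verts ?G)" "arcs ?H = arcs ?G \<union> ?E"
    "tail ?H = (\<lambda>e. if e \<in> ?E then s' else tail ?G e)"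
    "head ?H = (\<lambda>e. if e \<in> ?E then source N else head ?G e)"
    "source N' = s'" "terminals N' = terminals N"
    by (simp_all add: N'_def add_source_def)
  interpret H: fin_digraph ?H
    using source_in_verts by unfold_locales auto
  have not_new: "e \<notin> ?E" if "e \<in> arcs ?G" for e using that e' by blast
  have head_new: "head ?H e \<noteq> s'" if "e \<in> arcs ?H" for e
    using that s' source_in_verts head_in_verts by auto
  have dom: "u \<rightarrow>\<^bsub>?H\<^esub> v" if "u \<rightarrow>\<^bsub>?G\<^esub> v" for u v
  proof -
    from that obtain e where e: "e \<in> arcs ?G" "tail ?G e = u" "head ?G e = v" by blast
    have "arc_to_ends ?H e = (u, v)"
      unfolding arc_to_ends_def H using e not_new[OF e(1)] by simp
    then show ?thesis using e by (intro H.dominatesI[of e]) auto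
  qed
  have reach: "u \<rightarrow>\<^sup>*\<^bsub>?H\<^esub> v" if "u \<rightarrow>\<^sup>*\<^bsub>?G\<^esub> v" for u v
    using that
  proof (induction rule: reachable_induct)
    case base
    then show ?case by (intro H.reachable_refl) simp
  next
    case (step x y)
    then show ?case using dom H.reachable_adj_trans by blast
  qed
  have start: "s' \<rightarrow>\<^sup>*\<^bsub>?H\<^esub> source N"
  proof -
    have E: "e' 1 \<in> ?E" using mu_pos by auto
    then have "arc_to_ends ?H (e' 1) = (s', source N)" unfolding arc_to_ends_def H by simp
    then show ?thesis using E by (intro H.reachable_adjI H.dominatesI[of "e' 1"]) auto
  qed
  show ?thesis unfolding N'_def[symmetric]
  proof
    show "\<nexists>p. H.cycle p"
    proof
      assume "\<exists>p. H.cycle p"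
      then obtain u p where p: "H.awalk u p u" "distinct (tl (H.awalk_verts u p))" "p \<noteq> []"
        unfolding H.cycle_def by blast
      have cas: "H.cas u p u" and sub: "set p \<subseteq> arcs ?H" using p(1) by (auto simp: H.awalk_def)
      have "map (tail ?H) p @ [head ?H (last p)] = tail ?H (hd p) # map (head ?H) p"
        using H.awalk_verts_conv[of u p] H.awalk_verts_conv'[OF cas] p(3) by simp
      moreover have "tail ?H (hd p) = u" using cas p(3) by (cases p) auto
      moreover have "head ?H (last p) = u"
        using H.awlast_if_cas[OF cas] H.awalk_verts_conv[of u p] p(3) by simp
      ultimately have "set (map (tail ?H) p) \<subseteq> set (u # map (head ?H) p)"
        by (metis Un_upper1 set_append)
      moreover have "u \<in> set (map (head ?H) p)"
        using \<open>head ?H (last p) = u\<close> p(3) by (metis image_eqI last_in_set set_map)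
      ultimately have "tail ?H ` set p \<subseteq> head ?H ` set p"
        by (simp only: set_map list.set insert_absorb)
      moreover have "s' \<notin> head ?H ` set p" using head_new sub by blast
      ultimately have ts: "tail ?H e \<noteq> s'" if "e \<in> set p" for e using that by blast
      have old: "set p \<inter> ?E = {}"
      proof (rule ccontr)
        assume "set p \<inter> ?E \<noteq> {}"
        then obtain e where "e \<in> set p" "e \<in> ?E" by blast
        then show False using ts[of e] by simp
      qed
      have c: "cas v q z \<longleftrightarrow> H.cas v q z" and a: "awalk_verts v q = H.awalk_verts v q"
        if "set q \<inter> ?E = {}" for v q z
        using that by (induction q arbitrary: v) auto
      have "u \<in> verts ?G"
      proof -
        have "hd p \<in> set p" using p(3) by simp
        then have "hd p \<in> arcs ?G" "hd p \<notin> ?E" using sub old by auto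
        then show ?thesis using \<open>tail ?H (hd p) = u\<close> tail_in_verts[of "hd p"] by simp
      qed
      then have "awalk u p u" using cas sub old c[OF old] by (auto simp: awalk_def)
      then have "cycle p" using p(2,3) a[OF old] unfolding cycle_def by auto
      then show False using acyclic by blast
    qed
    show "source N' \<in> verts ?H" by simp
    show "terminals N' \<subseteq> verts ?H - {source N'}" using terminals_subset s' by auto
    show "terminals N' \<noteq> {}" using terminals_nonempty by simp
    show "in_arcs ?H (source N') = {}"
      using head_new unfolding in_arcs_def H(5) by blast
    fix T assume T: "T \<in> terminals N'"
    then have "T \<noteq> s'" "out_arcs ?G T = {}"
      using terminal_no_out terminals_subset s' by auto
    then show "out_arcs ?H T = {}" by (auto simp: out_arcs_def)
    show "source N' \<rightarrow>\<^sup>*\<^bsub>?H\<^esub> T"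
      using T start reach[OF terminal_reachable] H.reachable_trans by simp
  next
    fix V assume V: "V \<in> intermediate N'"
    then consider "V = source N" | "V \<in> intermediate N" by (auto simp: intermediate_def)
    note cs = this
    from cs show "source N' \<rightarrow>\<^sup>*\<^bsub>?H\<^esub> V"
    proof cases
      case 1 then show ?thesis using start by simp
    next
      case 2 then show ?thesis
        using start reach[OF intermediate_reachable[OF 2]] H.reachable_trans by simp
    qed
    from cs show "\<exists>T\<in>terminals N'. V \<rightarrow>\<^sup>*\<^bsub>?H\<^esub> T"
    proof cases
      case 1 then show ?thesis using terminals_nonempty terminal_reachable reach by auto
    next
      case 2 then show ?thesis using intermediate_reaches[OF 2] reach by auto
    qed
  qed
qed

end

theory Submission
  imports Defs
begin

text \<open>
  If the new source emits \<open>x\<close>, then the old source emits \<open>F\<^sub>S x\<close>, and all old edges carry the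
  same symbols as in the old network with \<open>F\<^sub>S x\<close> emitted at its source.  Hence the transfer
  functions of the new network are those of the old one composed with \<open>F\<^sub>S\<close>, and injectivity of
  such a composition gives injectivity on the image of \<open>F\<^sub>S\<close>.
\<close>

text \<open>Sortedness of a list compares only its own entries, which all lie in \<open>E\<close>.
  The two descriptions thus have the same defining predicate, so they agree whatever
  \<open>r\<close> is.\<close>

lemma coords_Restr:
  assumes "X \<subseteq> E"
  shows "coords (Restr r E) X = coords r X"
proof -
  have "sorted_wrt (\<lambda>d e. (d, e) \<in> Restr r E) es = sorted_wrt (\<lambda>d e. (d, e) \<in> r) es"
    if "set es = X" for es
  proof -
    have "set es \<subseteq> E" using that assms by simp
    then show ?thesis by (induction es) auto
  qed
  then show ?thesis unfolding coords_def by (intro arg_cong[where f = The] ext) auto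
qed

lemma linear_order_on_Restr_subset:
  assumes "linear_order_on E r" "B \<subseteq> E"
  shows "linear_order_on B (Restr r B)"
proof -
  have "x \<in> E" if "x \<in> B" for x using that assms(2) by blast
  then show ?thesis
    using assms(1) unfolding linear_order_on_def partial_order_on_def preorder_on_def
    by (auto simp: refl_on_def total_on_def intro: trans_Restr antisym_subset)
qed

locale network_add_source = network N for N :: "('v, 'e) net" +
  fixes s' :: 'v and e' :: "nat \<Rightarrow> 'e"
  assumes new_vertex: "s' \<notin> verts (dgr N)"
    and inj_new: "inj_on e' {1..mu N}"
    and new_arcs: "e' ` {1..mu N} \<inter> arcs (dgr N) = {}"
begin

abbreviation "N' \<equiv> add_source N s' e'"
abbreviation "E' \<equiv> e' ` {1..mu N}"

lemma add_source_simps [simp]: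
  "verts (dgr N') = insert s' (verts (dgr N))"
  "arcs (dgr N') = arcs (dgr N) \<union> E'"
  "tail (dgr N') e = (if e \<in> E' then s' else tail (dgr N) e)"
  "head (dgr N') e = (if e \<in> E' then source N else head (dgr N) e)"
  "source N' = s'" "terminals N' = terminals N"
  by (simp_all add: add_source_def)

text \<open>Provides for \<open>N'\<close> the facts proved for networks, in particular
  \<open>transmission_ex1\<close>.\<close>

sublocale N': network N'
  using new_vertex new_arcs by (rule network_add_source)

lemma old_not_new: "e \<in> arcs (dgr N) \<Longrightarrow> e \<notin> E'"
  using new_arcs by blast

lemma source_not_terminal: "source N \<notin> terminals N"
  using terminals_subset by blast

lemma intermediate_add_source: "intermediate N' = insert (source N) (intermediate N)"
  using source_in_verts source_not_terminal new_vertex terminals_subset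
  unfolding intermediate_def add_source_simps by auto

lemma source_not_intermediate: "source N \<notin> intermediate N"
  by (simp add: intermediate_def)

lemma out_arcs_add_source:
  assumes "V \<in> verts (dgr N)"
  shows "out_arcs (dgr N') V = out_arcs (dgr N) V"
  using assms new_vertex old_not_new
  unfolding out_arcs_def add_source_simps by (auto split: if_splits)

lemma in_arcs_add_source:
  assumes "V \<noteq> source N"
  shows "in_arcs (dgr N') V = in_arcs (dgr N) V"
  using assms old_not_new
  unfolding in_arcs_def add_source_simps by (auto split: if_splits)

lemma out_arcs_new_source: "out_arcs (dgr N') s' = E'"
proof -
  have "tail (dgr N) e \<noteq> s'" if "e \<in> arcs (dgr N)" for e
    using that new_vertex tail_in_verts by blast
  then show ?thesis
    unfolding out_arcs_def add_source_simps by auto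
qed

lemma in_arcs_old_source: "in_arcs (dgr N') (source N) = E'"
  using source_no_in unfolding in_arcs_def add_source_simps by auto

lemma card_new: "card E' = mu N"
  using inj_new by (simp add: card_image)

text \<open>Old edges keep their ends in \<open>N'\<close>. This lets the path order of
  \<open>N\<close> be read off from that of \<open>N'\<close>.\<close>

lemma awalk_add_source:
  assumes "awalk u p v"
  shows "N'.awalk u p v" "N'.awalk_verts u p = awalk_verts u p"
proof -
  have p: "set p \<subseteq> arcs (dgr N)" using assms by (auto simp: awalk_def)
  have "N'.cas u p v = cas u p v" "N'.awalk_verts u p = awalk_verts u p"
    using p old_not_new by (induction p arbitrary: u) auto
  then show "N'.awalk u p v" "N'.awalk_verts u p = awalk_verts u p"
    using assms p by (auto simp: awalk_def N'.awalk_def)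
qed

text \<open>A path of \<open>N\<close> is also a path of \<open>N'\<close>, so \<open>r\<close>
  relates its first and last edge; both are old edges, so the pair survives the restriction.\<close>

lemma edge_order_Restr:
  assumes "edge_order N' r"
  shows "edge_order N (Restr r (arcs (dgr N)))"
  unfolding edge_order_def
proof (intro conjI allI impI)
  show "linear_order_on (arcs (dgr N)) (Restr r (arcs (dgr N)))"
    using assms by (auto simp: edge_order_def intro: linear_order_on_Restr_subset)
  fix u p v assume p: "apath u p v \<and> p \<noteq> []"
  then have "N'.apath u p v"
    using awalk_add_source[of u p v] by (simp add: apath_def N'.apath_def)
  then have "(hd p, last p) \<in> r"
    using assms p by (auto simp: edge_order_def)
  moreover have "set p \<subseteq> arcs (dgr N)" using p by (auto simp: apath_def awalk_def)
  ultimately show "(hd p, last p) \<in> Restr r (arcs (dgr N))"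
    using p by auto
qed

text \<open>An intermediate vertex of \<open>N\<close> has the same incoming and outgoing edges in
  both networks. Restricting \<open>F\<close> meets the extensionality in
  \<open>network_code\<close> and expresses the removal of the function at the old source.\<close>

lemma network_code_restrict:
  assumes "network_code N' A F"
  shows "network_code N A (restrict F (intermediate N))"
proof -
  have "F V \<in> vectors A (in_degree (dgr N) V) \<rightarrow> vectors A (out_degree (dgr N) V)"
    if V: "V \<in> intermediate N" for V
  proof -
    have "V \<in> intermediate N'" using V intermediate_add_source by simp
    moreover have "V \<in> verts (dgr N)" "V \<noteq> source N" using V by (auto simp: intermediate_def)
    ultimately show ?thesis
      using assms out_arcs_add_source[of V] in_arcs_add_source[of V]
      unfolding network_code_def in_degree_def out_degree_def by (fastforce dest: PiE_mem)
  qed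
  then show ?thesis by (simp add: network_code_def)
qed

text \<open>In \<open>N'\<close> the old source has exactly the new edges coming in,
  \<open>mu N\<close> many by injectivity of \<open>e'\<close>, and its outgoing edges are those it
  has in \<open>N\<close>.\<close>

lemma source_code_in_vectors:
  assumes "network_code N' A F" "x \<in> vectors A (mu N)"
  shows "F (source N) x \<in> vectors A (out_degree (dgr N) (source N))"
proof -
  have "F (source N) \<in> vectors A (in_degree (dgr N') (source N))
      \<rightarrow> vectors A (out_degree (dgr N') (source N))"
    using assms(1) intermediate_add_source unfolding network_code_def by (blast dest: PiE_mem)
  then show ?thesis
    using assms(2) source_in_verts
    by (auto simp: in_degree_def out_degree_def in_arcs_old_source out_arcs_add_source card_new
        simp del: One_nat_def)
qed

lemma transmission_restrict:
  assumes "transmission N' r F x w" "edge_order N' r"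
    and "map w (coords r E') = x"
  shows "transmission N (Restr r (arcs (dgr N))) (restrict F (intermediate N))
    (F (source N) x) (restrict w (arcs (dgr N)))"
proof -
  let ?E = "arcs (dgr N)"
  have lin: "linear_order_on (arcs (dgr N')) r" using assms(2) by (simp add: edge_order_def)
  \<comment> \<open>On coordinates of old edges, neither the restriction of the order nor that of
    \<open>w\<close> has any effect.\<close>
  have co: "map (restrict w ?E) (coords (Restr r ?E) X) = map w (coords r X)" if "X \<subseteq> ?E" for X
  proof -
    have "finite X" using that finite_arcs finite_subset by blast
    then have "set (coords r X) = X" using set_coords[OF lin] that by auto
    then show ?thesis using that by (auto simp: coords_Restr)
  qed
  have eq: "map w (coords r (out_arcs (dgr N') V)) = F V (map w (coords r (in_arcs (dgr N') V)))"
    if "V \<in> intermediate N'" for V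
    using assms(1) that unfolding transmission_def by blast
  \<comment> \<open>The vertex equation of \<open>N'\<close> at the old source, whose incoming
    symbols form \<open>x\<close>, turns into the emission condition of \<open>N\<close>.\<close>
  have "map w (coords r (out_arcs (dgr N) (source N))) = F (source N) x"
    using eq[of "source N"] assms(3) source_in_verts
    by (simp add: intermediate_add_source out_arcs_add_source in_arcs_old_source)
  moreover have "map w (coords r (out_arcs (dgr N) V)) = F V (map w (coords r (in_arcs (dgr N) V)))"
    if "V \<in> intermediate N" for V
  proof -
    have "V \<in> verts (dgr N)" "V \<noteq> source N" using that by (auto simp: intermediate_def)
    then show ?thesis
      using eq[of V] that
      by (simp add: intermediate_add_source out_arcs_add_source in_arcs_add_source)
  qed
  moreover have "out_arcs (dgr N) V \<subseteq> ?E" "in_arcs (dgr N) V \<subseteq> ?E" for V by auto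
  ultimately show ?thesis by (simp add: transmission_def co)
qed

text \<open>Transmissions are unique in both networks, so the one of \<open>N'\<close> for
  \<open>x\<close>, cut down to the old edges, must be the one of \<open>N\<close> for
  \<open>F (source N) x\<close>. The edges into a terminal are old, hence the same symbols
  arrive.\<close>

lemma transfer_fun_add_source:
  assumes r: "edge_order N' r" and F: "network_code N' A F"
    and x: "x \<in> vectors A (mu N)" and T: "T \<in> terminals N"
  shows "transfer_fun N (Restr r (arcs (dgr N))) (restrict F (intermediate N)) T
      (F (source N) x) = transfer_fun N' r F T x"
proof -
  let ?r = "Restr r (arcs (dgr N))" and ?F = "restrict F (intermediate N)"
  have "x \<in> vectors A (out_degree (dgr N') (source N'))"
    using x by (simp add: out_degree_def out_arcs_new_source card_new del: One_nat_def)
  from N'.transmission_ex1[OF r F this] obtain w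
    where w: "transmission N' r F x w" and THE_w: "(THE w. transmission N' r F x w) = w"
    by (metis the1_equality)
  have "map w (coords r E') = x"
    using w by (simp add: transmission_def out_arcs_new_source)
  then have "transmission N ?r ?F (F (source N) x) (restrict w (arcs (dgr N)))"
    using transmission_restrict[OF w r] by simp
  then have THE_r: "(THE w. transmission N ?r ?F (F (source N) x) w) = restrict w (arcs (dgr N))"
    by (intro the1_equality transmission_ex1[OF edge_order_Restr[OF r] network_code_restrict[OF F]
          source_code_in_vectors[OF F x]])
  have in_T: "in_arcs (dgr N') T = in_arcs (dgr N) T"
    using T source_not_terminal by (intro in_arcs_add_source) auto
  \<comment> \<open>Ensures that only old edges are listed, where \<open>w\<close> and its
    restriction agree.\<close>
  have "set (coords r (in_arcs (dgr N) T)) = in_arcs (dgr N) T"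
    using r by (intro set_coords[of "arcs (dgr N')"]) (auto simp: edge_order_def)
  moreover have "coords ?r (in_arcs (dgr N) T) = coords r (in_arcs (dgr N) T)"
    by (rule coords_Restr) auto
  ultimately show ?thesis
    unfolding transfer_fun_def THE_w THE_r in_T by auto
qed

end

theorem corollary1:
  fixes N N' :: "('v, 'e) net" and A :: "'a set"
    and s' :: 'v and e' :: "nat \<Rightarrow> 'e" and r :: "('e \<times> 'e) set"
    and F :: "'v \<Rightarrow> 'a list \<Rightarrow> 'a list"
  assumes "network N" and "alphabet A"
    and "s' \<notin> verts (dgr N)"
    and "inj_on e' {1..mu N}" and "e' ` {1..mu N} \<inter> arcs (dgr N) = {}"
    and "N' = add_source N s' e'"
    and "edge_order N' r"
    and "network_code N' A F"
    and "unambiguous N' r A (vectors A (mu N)) F"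
  shows "unambiguous N (Restr r (arcs (dgr N))) A
           {F (source N) x | x. x \<in> vectors A (mu N)}
           (restrict F (intermediate N' - {source N}))"
proof -
  interpret network_add_source N s' e'
    using assms(1,3-5) by (simp add: network_add_source_def network_add_source_axioms_def)
  note r = assms(7)[unfolded assms(6)] and F = assms(8)[unfolded assms(6)]
  let ?C = "F (source N) ` vectors A (mu N)"
  have C: "{F (source N) x | x. x \<in> vectors A (mu N)} = ?C" by auto
  have I: "intermediate N' - {source N} = intermediate N"
    using intermediate_add_source source_not_intermediate assms(6) by simp
  \<comment> \<open>Nonemptiness is part of being an outer code for \<open>N'\<close>.\<close>
  have "vectors A (mu N) \<noteq> {}"
    using assms(9) by (simp add: unambiguous_def outer_code_def)
  then have "outer_code N A ?C"
    using source_code_in_vectors[OF F] by (auto simp: outer_code_def)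
  moreover have "inj_on (transfer_fun N (Restr r (arcs (dgr N))) (restrict F (intermediate N)) T) ?C"
    if T: "T \<in> terminals N" for T
  \<comment> \<open>Injectivity of g on the image of f follows from injectivity of the composition
    of g after f; here that composition agrees on \<open>vectors A (mu N)\<close> with the transfer
    function of \<open>N'\<close>.\<close>
  proof (rule inj_on_imageI, rule inj_on_cong[THEN iffD2])
    show "inj_on (transfer_fun (add_source N s' e') r F T) (vectors A (mu N))"
      using assms(6,9) T by (simp add: unambiguous_def)
  qed (simp add: transfer_fun_add_source[OF r F _ T])
  ultimately show ?thesis
    using network_code_restrict[OF F] unfolding unambiguous_def C I by simp
qed

end
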